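(* Let $W\in C^2_{\mathrm{loc}}(\mathbb{R}^N)$ and let $a^\pm$ be local minima of $W$ with $W(a^-)<0=W(a^+)$, $a^-$ a global minimum of $W$, and $W^{-1}([W(a^-),0])$ compact in $\mathbb{R}^N$. Let $r_0>0$ be such that $W(u)\ge0$ for $|u-a^+|\le r_0$ and $W(u)<0$ for $|u-a^-|\le r_0$. If $L>0$ and $c>0$ are fixed, then there exists $U_L\in\mathcal{X}_L$ with \[ E_c(U_L)=\inf_{V\in\mathcal{X}_L}E_c(V). \]
   Context: For $c>0$ and $U\in[H^1_{\mathrm{loc}}(\mathbb{R})]^N$, $E_c(U):=\int_{\mathbb{R}}\big(\tfrac12|U_x|^2+W(U)\big)e^{cx}\,dx$. $\mathcal{X}_L:=\{U\in[H^1_{\mathrm{loc}}(\mathbb{R})]^N: |U(x)-a^+|\le r_0 \text{ for } x\ge L,\ |U(x)-a^-|\le r_0 \text{ for } x\le -L\}$ (pointwise values via the continuous representative). *)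

theory Defs
  imports "HOL-Analysis.Analysis"
begin

definition C2_fun :: "('a::euclidean_space \<Rightarrow> real) \<Rightarrow> bool" where
  "C2_fun W \<longleftrightarrow> (\<exists>DW :: 'a \<Rightarrow> ('a \<Rightarrow>\<^sub>L real). \<exists>D2W :: 'a \<Rightarrow> ('a \<Rightarrow>\<^sub>L ('a \<Rightarrow>\<^sub>L real)).
      (\<forall>x. (W has_derivative blinfun_apply (DW x)) (at x)) \<and>
      (\<forall>x. (DW has_derivative blinfun_apply (D2W x)) (at x)) \<and>
      continuous_on UNIV D2W)"

definition local_min :: "('a::euclidean_space \<Rightarrow> real) \<Rightarrow> 'a \<Rightarrow> bool" where
  "local_min W a \<longleftrightarrow> (\<exists>e>0. \<forall>u. dist u a < e \<longrightarrow> W a \<le> W u)"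

text \<open>g is a weak derivative of U on the real line, in L^2_loc:
  U(b) - U(a) = integral of g over [a,b]. In one dimension this is the
  H^1_loc condition; U is then the continuous representative.\<close>
definition weak_deriv_L2loc :: "(real \<Rightarrow> 'a::euclidean_space) \<Rightarrow> (real \<Rightarrow> 'a) \<Rightarrow> bool" where
  "weak_deriv_L2loc U g \<longleftrightarrow>
     (\<forall>a b. g absolutely_integrable_on {a..b} \<and>
            (\<lambda>x. (norm (g x))\<^sup>2) integrable_on {a..b}) \<and>
     (\<forall>a b. a \<le> b \<longrightarrow> U b - U a = integral {a..b} g)"

definition H1loc :: "(real \<Rightarrow> 'a::euclidean_space) \<Rightarrow> bool" where
  "H1loc U \<longleftrightarrow> (\<exists>g. weak_deriv_L2loc U g)"

definition wderiv :: "(real \<Rightarrow> 'a::euclidean_space) \<Rightarrow> real \<Rightarrow> 'a" where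
  "wderiv U = (SOME g. weak_deriv_L2loc U g)"

definition Ec :: "real \<Rightarrow> ('a::euclidean_space \<Rightarrow> real) \<Rightarrow> (real \<Rightarrow> 'a) \<Rightarrow> ereal" where
  "Ec c W U =
     (let f = (\<lambda>x. (1/2 * (norm (wderiv U x))\<^sup>2 + W (U x)) * exp (c * x)) in
      enn2ereal (\<integral>\<^sup>+ x. ennreal (f x) \<partial>lborel) - enn2ereal (\<integral>\<^sup>+ x. ennreal (- f x) \<partial>lborel))"

definition XL :: "real \<Rightarrow> real \<Rightarrow> 'a::euclidean_space \<Rightarrow> 'a \<Rightarrow> (real \<Rightarrow> 'a) set" where
  "XL L r0 am ap = {U. H1loc U \<and> (\<forall>x\<ge>L. norm (U x - ap) \<le> r0) \<and> (\<forall>x\<le>-L. norm (U x - am) \<le> r0)}"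

end

(* The direct method. Since W >= W(a^-) everywhere and W >= 0 near a^+, the negative part of the energy
   is bounded by a fixed finite integral over x < L, so a minimizing sequence U_k has bounded weighted
   kinetic energy. It is therefore locally uniformly Hoelder continuous, and bounded at x = L by the
   constraint, so a subsequence converges pointwise. The limit has a weak derivative whose kinetic energy
   is at most the liminf, and Fatou's lemma treats the potential part. *)
theory Submission
  imports Defs "HOL-Complex_Analysis.Great_Picard"
begin

section \<open>Square-integrable functions\<close>

text \<open>A difference of two extended reals is hard to compare when infinite values occur.
  Shifting by one finite constant turns the energy on the constraint class into a sum of two
  integrals of nonnegative functions, where infinite values are harmless. Pointwise convergence of
  \<open>U_k\<close> does not by itself control the derivatives. However, increments of
  \<open>U_k\<close> are pairings of the weighted derivatives with fixed L2 functions, so these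
  pairings already converge. What remains is to find an L2 function with the limiting pairings and
  norm at most the liminf, which is a minimal-norm argument in a Hilbert space. The weight
  degenerates at minus infinity, so no uniform convergence can be expected there. Pointwise
  convergence suffices: the constraints are closed, and both parts of the energy are lower
  semicontinuous on the whole line. \<open>wderiv\<close> is an arbitrary choice; almost everywhere
  uniqueness makes it interchangeable with the derivative produced by the limit.\<close>

definition L2 :: "'x measure \<Rightarrow> ('x \<Rightarrow> 'a::euclidean_space) \<Rightarrow> bool" where
  "L2 M f \<longleftrightarrow> f \<in> borel_measurable M \<and> integrable M (\<lambda>x. (norm (f x))\<^sup>2)"

lemma parallelogram_law:
  fixes a b :: "'a::real_inner"
  shows "(norm (a + b))\<^sup>2 + (norm (a - b))\<^sup>2 = 2 * (norm a)\<^sup>2 + 2 * (norm b)\<^sup>2"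
  by (simp add: power2_norm_eq_inner inner_simps inner_commute)

lemma L2_measurable: "L2 M f \<Longrightarrow> f \<in> borel_measurable M"
  by (simp add: L2_def)

lemma L2_integrable: "L2 M f \<Longrightarrow> integrable M (\<lambda>x. (norm (f x))\<^sup>2)"
  by (simp add: L2_def)

lemma L2_scaleR: "L2 M f \<Longrightarrow> L2 M (\<lambda>x. c *\<^sub>R f x)"
  by (auto simp: L2_def power_mult_distrib)

lemma L2_add:
  assumes "L2 M f" "L2 M g"
  shows "L2 M (\<lambda>x. f x + g x)"
  unfolding L2_def
proof
  note [measurable] = assms[THEN L2_measurable]
  show "(\<lambda>x. f x + g x) \<in> borel_measurable M" by measurable
  show "integrable M (\<lambda>x. (norm (f x + g x))\<^sup>2)"
  proof (rule Bochner_Integration.integrable_bound)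
    show "integrable M (\<lambda>x. 2 * (norm (f x))\<^sup>2 + 2 * (norm (g x))\<^sup>2)"
      by (intro Bochner_Integration.integrable_add integrable_mult_right L2_integrable assms)
    have "(norm (f x + g x))\<^sup>2 \<le> 2 * (norm (f x))\<^sup>2 + 2 * (norm (g x))\<^sup>2" for x
      using parallelogram_law[of "f x" "g x"] zero_le_power2[of "norm (f x - g x)"] by linarith
    then show "AE x in M. norm ((norm (f x + g x))\<^sup>2) \<le> norm (2 * (norm (f x))\<^sup>2 + 2 * (norm (g x))\<^sup>2)"
      by auto
  qed measurable
qed

lemma L2_diff: "L2 M f \<Longrightarrow> L2 M g \<Longrightarrow> L2 M (\<lambda>x. f x - g x)"
  using L2_add[OF _ L2_scaleR[of M g "-1"], of f] by simp

lemma L2_nn_integral: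
  "L2 M f \<Longrightarrow> (\<integral>\<^sup>+x. ennreal ((norm (f x))\<^sup>2) \<partial>M) = ennreal (\<integral>x. (norm (f x))\<^sup>2 \<partial>M)"
  by (auto simp: L2_def intro!: nn_integral_eq_integral)

lemma L2_mult_integrable:
  fixes \<phi> :: "'x \<Rightarrow> real"
  assumes "L2 M \<phi>" "L2 M f"
  shows "integrable M (\<lambda>x. \<phi> x *\<^sub>R f x)"
proof (rule Bochner_Integration.integrable_bound)
  note [measurable] = assms[THEN L2_measurable]
  show "integrable M (\<lambda>x. (norm (\<phi> x))\<^sup>2 + (norm (f x))\<^sup>2)"
    using assms by (auto simp: L2_def)
  have "\<bar>\<phi> x\<bar> * norm (f x) \<le> (\<phi> x)\<^sup>2 + (norm (f x))\<^sup>2" for x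
  proof -
    have "2 * (\<bar>\<phi> x\<bar> * norm (f x)) \<le> (\<phi> x)\<^sup>2 + (norm (f x))\<^sup>2"
      using sum_squares_bound[of "\<bar>\<phi> x\<bar>" "norm (f x)"] by (simp add: mult.assoc)
    moreover have "0 \<le> \<bar>\<phi> x\<bar> * norm (f x)" by simp
    ultimately show ?thesis by linarith
  qed
  then show "AE x in M. norm (\<phi> x *\<^sub>R f x) \<le> norm ((norm (\<phi> x))\<^sup>2 + (norm (f x))\<^sup>2)"
    by auto
  show "(\<lambda>x. \<phi> x *\<^sub>R f x) \<in> borel_measurable M" by measurable
qed

text \<open>Moving the norm inside reduces the vector-valued pairing to the scalar inequality for
  nonnegative integrals, applied to \<open>\<bar>\<phi> x\<bar>\<close> and
  \<open>norm (f x)\<close>.\<close>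

lemma L2_Cauchy_Schwarz:
  fixes \<phi> :: "'x \<Rightarrow> real"
  assumes "L2 M \<phi>" "L2 M f"
  shows "(norm (\<integral>x. \<phi> x *\<^sub>R f x \<partial>M))\<^sup>2 \<le> (\<integral>x. (\<phi> x)\<^sup>2 \<partial>M) * (\<integral>x. (norm (f x))\<^sup>2 \<partial>M)"
proof -
  note [measurable] = assms[THEN L2_measurable]
  have "norm (\<integral>x. \<phi> x *\<^sub>R f x \<partial>M) \<le> (\<integral>x. \<bar>\<phi> x\<bar> * norm (f x) \<partial>M)"
    using integral_norm_bound[of M "\<lambda>x. \<phi> x *\<^sub>R f x"] by simp
  moreover have "ennreal ((\<integral>x. \<bar>\<phi> x\<bar> * norm (f x) \<partial>M)\<^sup>2)
      \<le> ennreal ((\<integral>x. (\<phi> x)\<^sup>2 \<partial>M) * (\<integral>x. (norm (f x))\<^sup>2 \<partial>M))"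
  proof -
    have "integrable M (\<lambda>x. \<bar>\<phi> x\<bar> * norm (f x))"
      using integrable_norm[OF L2_mult_integrable[OF assms]] by simp
    then have "ennreal (\<integral>x. \<bar>\<phi> x\<bar> * norm (f x) \<partial>M) = (\<integral>\<^sup>+x. ennreal \<bar>\<phi> x\<bar> * ennreal (norm (f x)) \<partial>M)"
      by (subst nn_integral_eq_integral[symmetric]) (auto simp: ennreal_mult)
    then have "ennreal ((\<integral>x. \<bar>\<phi> x\<bar> * norm (f x) \<partial>M)\<^sup>2) = (\<integral>\<^sup>+x. ennreal \<bar>\<phi> x\<bar> * ennreal (norm (f x)) \<partial>M)\<^sup>2"
      by (simp flip: ennreal_power add: integral_nonneg_AE)
    also have "\<dots> \<le> (\<integral>\<^sup>+x. (ennreal \<bar>\<phi> x\<bar>)\<^sup>2 \<partial>M) * (\<integral>\<^sup>+x. (ennreal (norm (f x)))\<^sup>2 \<partial>M)"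
      by (rule Cauchy_Schwarz_nn_integral) measurable
    also have "\<dots> = ennreal (\<integral>x. (\<phi> x)\<^sup>2 \<partial>M) * ennreal (\<integral>x. (norm (f x))\<^sup>2 \<partial>M)"
      using L2_nn_integral[OF assms(1)] L2_nn_integral[OF assms(2)] by (simp add: ennreal_power)
    finally show ?thesis by (simp add: ennreal_mult)
  qed
  then have "(\<integral>x. \<bar>\<phi> x\<bar> * norm (f x) \<partial>M)\<^sup>2 \<le> (\<integral>x. (\<phi> x)\<^sup>2 \<partial>M) * (\<integral>x. (norm (f x))\<^sup>2 \<partial>M)"
    by (subst (asm) ennreal_le_iff) auto
  ultimately show ?thesis
    by (meson norm_ge_zero order_trans power_mono)
qed

text \<open>Riesz-Fischer: a subsequence with fast decaying increments converges almost everywhere,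
  and Fatou's lemma along it turns the Cauchy estimate into convergence of the whole
  sequence.\<close>

lemma L2_complete:
  fixes h :: "nat \<Rightarrow> 'x \<Rightarrow> 'a::euclidean_space"
  assumes L2: "\<And>n. L2 M (h n)"
    and Cauchy: "\<And>e. e > 0 \<Longrightarrow> \<exists>N. \<forall>n\<ge>N. \<forall>m\<ge>n. (\<integral>x. (norm (h m x - h n x))\<^sup>2 \<partial>M) < e"
  obtains g where "L2 M g" "(\<lambda>n. \<integral>x. (norm (g x - h n x))\<^sup>2 \<partial>M) \<longlonglongrightarrow> 0"
proof -
  note [measurable] = L2[THEN L2_measurable]
  \<comment> \<open>The rate \<open>(1/4)^j\<close> leaves room for a weight \<open>2^j\<close>: the
    weighted squared increments still have finite total integral, so their sum is finite almost
    everywhere.\<close>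
  have "\<exists>N. \<forall>j. (\<forall>n\<ge>N j. \<forall>m\<ge>n. (\<integral>x. (norm (h m x - h n x))\<^sup>2 \<partial>M) < (1/4)^j)"
    using Cauchy by (intro choice) auto
  then obtain N where N: "\<And>j n m. n \<ge> N j \<Longrightarrow> m \<ge> n \<Longrightarrow> (\<integral>x. (norm (h m x - h n x))\<^sup>2 \<partial>M) < (1/4)^j"
    by blast
  \<comment> \<open>Summing the thresholds makes \<open>s\<close> monotone with
    \<open>s j \<ge> N j\<close>; the extra \<open>j\<close> drives it to infinity.\<close>
  define s where "s j = j + (\<Sum>i\<le>j. N i)" for j
  have s_mono: "s j \<le> s (Suc j)" and s_ge: "s j \<ge> j" for j by (simp_all add: s_def)
  have sN: "s j \<ge> N j" for j unfolding s_def by (intro trans_le_add2 member_le_sum) auto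
  define \<Delta> where "\<Delta> j x = h (s (Suc j)) x - h (s j) x" for j x
  have \<Delta>_meas[measurable]: "\<Delta> j \<in> borel_measurable M" for j unfolding \<Delta>_def by measurable
  have \<Delta>: "(\<integral>\<^sup>+x. ennreal ((norm (\<Delta> j x))\<^sup>2) \<partial>M) \<le> ennreal ((1/4)^j)" for j
    unfolding \<Delta>_def using L2_nn_integral[OF L2_diff[OF L2 L2], of "s (Suc j)" "s j"] N[OF sN s_mono, of j]
    by (simp add: ennreal_leI)
  have "(\<integral>\<^sup>+x. (\<Sum>j. ennreal (2^j * (norm (\<Delta> j x))\<^sup>2)) \<partial>M) = (\<Sum>j. \<integral>\<^sup>+x. ennreal (2^j * (norm (\<Delta> j x))\<^sup>2) \<partial>M)"
    by (rule nn_integral_suminf) measurable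
  also have "\<dots> \<le> (\<Sum>j. ennreal ((1/2)^j))"
  proof (intro suminf_le)
    fix j
    have "(\<integral>\<^sup>+x. ennreal (2^j * (norm (\<Delta> j x))\<^sup>2) \<partial>M) = ennreal (2^j) * (\<integral>\<^sup>+x. ennreal ((norm (\<Delta> j x))\<^sup>2) \<partial>M)"
      by (subst nn_integral_cmult[symmetric]) (auto simp: ennreal_mult)
    also have "\<dots> \<le> ennreal (2^j) * ennreal ((1/4)^j)"
      by (intro mult_left_mono \<Delta>) auto
    also have "\<dots> = ennreal ((1/2)^j)"
      by (simp flip: ennreal_mult power_mult_distrib)
    finally show "(\<integral>\<^sup>+x. ennreal (2^j * (norm (\<Delta> j x))\<^sup>2) \<partial>M) \<le> ennreal ((1/2)^j)" .
  qed auto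
  also have "\<dots> < \<infinity>"
    by (subst suminf_ennreal2) (auto simp: summable_geometric)
  finally have "AE x in M. (\<Sum>j. ennreal (2^j * (norm (\<Delta> j x))\<^sup>2)) \<noteq> \<infinity>"
    by (intro nn_integral_PInf_AE) auto
  then have AE_conv: "AE x in M. convergent (\<lambda>j. h (s j) x)"
  proof (rule AE_mp, intro AE_I2 impI)
    fix x assume "(\<Sum>j. ennreal (2^j * (norm (\<Delta> j x))\<^sup>2)) \<noteq> \<infinity>"
    then have S: "summable (\<lambda>j. 2^j * (norm (\<Delta> j x))\<^sup>2)"
      by (intro summable_suminf_not_top) auto
    have "summable (\<lambda>j. 2^j * (norm (\<Delta> j x))\<^sup>2 + (1/2)^j)"
      by (intro summable_add S summable_geometric) auto
    then have "summable (\<lambda>j. norm (\<Delta> j x))"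
    proof (rule summable_comparison_test_ev[rotated], intro always_eventually allI)
      fix j
      \<comment> \<open>Splitting the weight as \<open>sqrt (2^j) * sqrt ((1/2)^j) = 1\<close> lets
        the weighted squares and a geometric series together dominate
        \<open>norm (\<Delta> j x)\<close> itself.\<close>
      define a b where "a = sqrt (2^j) * norm (\<Delta> j x)" and "b = sqrt ((1/2)^j)"
      have ab: "a * b = norm (\<Delta> j x)" 
        by (simp add: a_def b_def flip: real_sqrt_mult power_mult_distrib)
      have "2 * a * b \<le> a\<^sup>2 + b\<^sup>2" by (rule sum_squares_bound)
      also have "\<dots> = 2^j * (norm (\<Delta> j x))\<^sup>2 + (1/2)^j"
        by (simp add: a_def b_def power_mult_distrib)
      finally show "norm (norm (\<Delta> j x)) \<le> 2^j * (norm (\<Delta> j x))\<^sup>2 + (1/2)^j"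
        using ab norm_ge_zero[of "\<Delta> j x"] by (simp add: mult.assoc del: norm_ge_zero)
    qed
    then have "summable (\<lambda>j. \<Delta> j x)" by (rule summable_norm_cancel)
    then have "convergent (\<lambda>n. h (s 0) x + (\<Sum>j<n. \<Delta> j x))"
      by (intro convergent_add convergent_const) (simp add: summable_iff_convergent)
    moreover have "h (s 0) x + (\<Sum>j<n. \<Delta> j x) = h (s n) x" for n
      unfolding \<Delta>_def by (subst sum_lessThan_telescope) simp
    ultimately show "convergent (\<lambda>j. h (s j) x)" by simp
  qed
  define g where "g x = lim (\<lambda>j. h (s j) x)" for x
  have [measurable]: "g \<in> borel_measurable M" unfolding g_def by measurable
  \<comment> \<open>Here \<open>n\<close> stays fixed and only \<open>h (s j)\<close> moves towards
    \<open>g\<close>, so Fatou's lemma transfers the Cauchy bound to the limit.\<close>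
  have tail: "(\<integral>\<^sup>+x. ennreal ((norm (g x - h n x))\<^sup>2) \<partial>M) \<le> ennreal e"
    if e: "e > 0" and n: "\<And>m. m \<ge> n \<Longrightarrow> (\<integral>x. (norm (h m x - h n x))\<^sup>2 \<partial>M) < e" for n e
  proof -
    have "(\<integral>\<^sup>+x. ennreal ((norm (g x - h n x))\<^sup>2) \<partial>M) =
        (\<integral>\<^sup>+x. liminf (\<lambda>j. ennreal ((norm (h (s j) x - h n x))\<^sup>2)) \<partial>M)"
    proof (rule nn_integral_cong_AE, use AE_conv in eventually_elim)
      case (elim x)
      then have "(\<lambda>j. h (s j) x) \<longlonglongrightarrow> g x" unfolding g_def by (simp add: convergent_LIMSEQ_iff)
      then have "(\<lambda>j. ennreal ((norm (h (s j) x - h n x))\<^sup>2)) \<longlonglongrightarrow> ennreal ((norm (g x - h n x))\<^sup>2)"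
        by (intro tendsto_intros)
      then show ?case by (intro lim_imp_Liminf[symmetric]) auto
    qed
    also have "\<dots> \<le> liminf (\<lambda>j. \<integral>\<^sup>+x. ennreal ((norm (h (s j) x - h n x))\<^sup>2) \<partial>M)"
      by (rule nn_integral_liminf) measurable
    also have "\<dots> \<le> limsup (\<lambda>j. \<integral>\<^sup>+x. ennreal ((norm (h (s j) x - h n x))\<^sup>2) \<partial>M)"
      by (intro Liminf_le_Limsup) auto
    also have "\<dots> \<le> ennreal e"
    proof (rule Limsup_bounded)
      show "\<forall>\<^sub>F j in sequentially. (\<integral>\<^sup>+x. ennreal ((norm (h (s j) x - h n x))\<^sup>2) \<partial>M) \<le> ennreal e"
        using eventually_ge_at_top[of n]
      proof eventually_elim
        case (elim j)
        then have "n \<le> s j" using s_ge[of j] by linarith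
        then show ?case
          using L2_nn_integral[OF L2_diff[OF L2 L2], of "s j" n] n[of "s j"] by (simp add: ennreal_leI)
      qed
    qed
    finally show ?thesis .
  qed
  have diff_L2: "L2 M (\<lambda>x. g x - h n x)" and diff_le: "(\<integral>x. (norm (g x - h n x))\<^sup>2 \<partial>M) \<le> e"
    if e: "e > 0" and n: "\<And>m. m \<ge> n \<Longrightarrow> (\<integral>x. (norm (h m x - h n x))\<^sup>2 \<partial>M) < e" for n e
  proof -
    have "(\<integral>\<^sup>+x. ennreal ((norm (g x - h n x))\<^sup>2) \<partial>M) < \<infinity>"
      using tail[OF that] by (rule le_less_trans) auto
    then show "L2 M (\<lambda>x. g x - h n x)"
      unfolding L2_def by (auto intro!: integrableI_bounded)
    from L2_nn_integral[OF this] tail[OF that] show "(\<integral>x. (norm (g x - h n x))\<^sup>2 \<partial>M) \<le> e"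
      using e by (simp add: ennreal_le_iff)
  qed
  show ?thesis
  proof
    obtain n0 where "\<forall>m\<ge>n0. (\<integral>x. (norm (h m x - h n0 x))\<^sup>2 \<partial>M) < 1"
      using Cauchy[of 1] by auto
    then have "L2 M (\<lambda>x. g x - h n0 x)" by (intro diff_L2[of 1]) auto
    from L2_add[OF this L2[of n0]] show "L2 M g" by simp
    show "(\<lambda>n. \<integral>x. (norm (g x - h n x))\<^sup>2 \<partial>M) \<longlonglongrightarrow> 0"
    proof (rule LIMSEQ_I)
      fix r :: real assume "r > 0"
      then obtain N where "\<forall>n\<ge>N. \<forall>m\<ge>n. (\<integral>x. (norm (h m x - h n x))\<^sup>2 \<partial>M) < r / 2"
        using Cauchy[of "r / 2"] by auto
      then have le: "(\<integral>x. (norm (g x - h n x))\<^sup>2 \<partial>M) \<le> r / 2" if "n \<ge> N" for n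
        using that \<open>r > 0\<close> by (intro diff_le) auto
      have "norm ((\<integral>x. (norm (g x - h n x))\<^sup>2 \<partial>M) - 0) < r" if "n \<ge> N" for n
        using le[OF that] \<open>r > 0\<close> by simp
      then show "\<exists>N. \<forall>n\<ge>N. norm ((\<integral>x. (norm (g x - h n x))\<^sup>2 \<partial>M) - 0) < r"
        by blast
    qed
  qed
qed

section \<open>Strong and weak limits in L2\<close>

lemma L2_tendsto_integral:
  fixes \<phi> :: "'x \<Rightarrow> real"
  assumes \<phi>: "L2 M \<phi>" and h: "\<And>n. L2 M (h n)" and g: "L2 M g"
    and lim: "(\<lambda>n. \<integral>x. (norm (g x - h n x))\<^sup>2 \<partial>M) \<longlonglongrightarrow> 0"
  shows "(\<lambda>n. \<integral>x. \<phi> x *\<^sub>R h n x \<partial>M) \<longlonglongrightarrow> (\<integral>x. \<phi> x *\<^sub>R g x \<partial>M)"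
proof (rule LIM_zero_cancel, rule tendsto_norm_zero_cancel)
  define C where "C = (\<integral>x. (\<phi> x)\<^sup>2 \<partial>M)"
  have bound: "norm ((\<integral>x. \<phi> x *\<^sub>R h n x \<partial>M) - (\<integral>x. \<phi> x *\<^sub>R g x \<partial>M))
      \<le> sqrt (C * (\<integral>x. (norm (g x - h n x))\<^sup>2 \<partial>M))" for n
  proof -
    have "(\<integral>x. \<phi> x *\<^sub>R (g x - h n x) \<partial>M) = (\<integral>x. \<phi> x *\<^sub>R g x \<partial>M) - (\<integral>x. \<phi> x *\<^sub>R h n x \<partial>M)"
      unfolding scaleR_diff_right by (intro Bochner_Integration.integral_diff L2_mult_integrable \<phi> h g)
    with L2_Cauchy_Schwarz[OF \<phi> L2_diff[OF g h[of n]]]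
    show ?thesis unfolding C_def by (intro real_le_rsqrt) (simp add: norm_minus_commute)
  qed
  have "(\<lambda>n. sqrt (C * (\<integral>x. (norm (g x - h n x))\<^sup>2 \<partial>M))) \<longlonglongrightarrow> sqrt (C * 0)"
    by (intro tendsto_intros lim)
  then have "(\<lambda>n. sqrt (C * (\<integral>x. (norm (g x - h n x))\<^sup>2 \<partial>M))) \<longlonglongrightarrow> 0" by simp
  then show "(\<lambda>n. norm ((\<integral>x. \<phi> x *\<^sub>R h n x \<partial>M) - (\<integral>x. \<phi> x *\<^sub>R g x \<partial>M))) \<longlonglongrightarrow> 0"
    by (rule Lim_null_comparison[rotated]) (use bound in auto)
qed

text \<open>Young's inequality \<open>(a + b)\<^sup>2 \<le> (1 + t) * a\<^sup>2 + (1 + 1/t) *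
  b\<^sup>2\<close> stands in for the triangle inequality of the L2 norm: for fixed \<open>t\<close>
  the last term vanishes in the limit, and then \<open>t\<close> tends to 0.\<close>

lemma L2_norm_le_limit:
  assumes h: "\<And>n. L2 M (h n)" and g: "L2 M g"
    and lim: "(\<lambda>n. \<integral>x. (norm (g x - h n x))\<^sup>2 \<partial>M) \<longlonglongrightarrow> 0"
    and d: "(\<lambda>n. \<integral>x. (norm (h n x))\<^sup>2 \<partial>M) \<longlonglongrightarrow> d"
  shows "(\<integral>x. (norm (g x))\<^sup>2 \<partial>M) \<le> d"
proof -
  have le: "(\<integral>x. (norm (g x))\<^sup>2 \<partial>M) \<le> (1 + t) * d" if t: "t > 0" for t
  proof (rule LIMSEQ_le_const)
    show "(\<lambda>n. (1 + t) * (\<integral>x. (norm (h n x))\<^sup>2 \<partial>M) + (1 + 1/t) * (\<integral>x. (norm (g x - h n x))\<^sup>2 \<partial>M)) \<longlonglongrightarrow> (1 + t) * d"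
      by (rule tendsto_eq_intros d lim refl | simp)+
    have "(\<integral>x. (norm (g x))\<^sup>2 \<partial>M) \<le> (1 + t) * (\<integral>x. (norm (h n x))\<^sup>2 \<partial>M) + (1 + 1/t) * (\<integral>x. (norm (g x - h n x))\<^sup>2 \<partial>M)" for n
    proof -
      have ptw: "(norm (g x))\<^sup>2 \<le> (1 + t) * (norm (h n x))\<^sup>2 + (1 + 1/t) * (norm (g x - h n x))\<^sup>2" for x
      proof -
        define a b where "a = norm (h n x)" and "b = norm (g x - h n x)"
        have "norm (g x) \<le> a + b"
          using norm_triangle_ineq[of "h n x" "g x - h n x"] by (simp add: a_def b_def)
        then have "(norm (g x))\<^sup>2 \<le> (a + b)\<^sup>2" by (intro power_mono) auto
        also have "\<dots> \<le> (1 + t) * a\<^sup>2 + (1 + 1/t) * b\<^sup>2"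
        proof -
          have "0 \<le> (sqrt t * a - b / sqrt t)\<^sup>2" by simp
          also have "\<dots> = t * a\<^sup>2 + b\<^sup>2 / t - 2 * a * b"
            using t by (simp add: power2_diff power_mult_distrib power_divide)
          finally show ?thesis by (simp add: power2_sum algebra_simps)
        qed
        finally show ?thesis by (simp add: a_def b_def)
      qed
      have I: "integrable M (\<lambda>x. (norm (h n x))\<^sup>2)" "integrable M (\<lambda>x. (norm (g x - h n x))\<^sup>2)" "integrable M (\<lambda>x. (norm (g x))\<^sup>2)"
        using h g L2_diff[OF g h] by (simp_all add: L2_integrable)
      have "(\<integral>x. (norm (g x))\<^sup>2 \<partial>M) \<le> (\<integral>x. (1 + t) * (norm (h n x))\<^sup>2 + (1 + 1/t) * (norm (g x - h n x))\<^sup>2 \<partial>M)"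
        by (intro integral_mono ptw I Bochner_Integration.integrable_add integrable_mult_right)
      also have "\<dots> = (1 + t) * (\<integral>x. (norm (h n x))\<^sup>2 \<partial>M) + (1 + 1/t) * (\<integral>x. (norm (g x - h n x))\<^sup>2 \<partial>M)"
        using I by simp
      finally show ?thesis .
    qed
    then show "\<exists>N. \<forall>n\<ge>N. (\<integral>x. (norm (g x))\<^sup>2 \<partial>M) \<le> (1 + t) * (\<integral>x. (norm (h n x))\<^sup>2 \<partial>M) + (1 + 1/t) * (\<integral>x. (norm (g x - h n x))\<^sup>2 \<partial>M)"
      by blast
  qed
  have "((\<lambda>t. (1 + t) * d) \<longlongrightarrow> (1 + 0) * d) (at_right 0)"
    by (intro tendsto_intros)
  then show ?thesis
    by (intro tendsto_lowerbound[where F = "at_right (0::real)" and f = "\<lambda>t. (1 + t) * d"])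
      (auto intro!: eventually_at_rightI[of 0 1] le)
qed

text \<open>Weak sequential compactness is bypassed: elements of almost minimal norm in the nested convex sets
  \<^term>\<open>C n\<close> below, which contain the tails of the sequence, are Cauchy by the parallelogram law.\<close>
lemma L2_weak_limit:
  fixes G :: "nat \<Rightarrow> 'x \<Rightarrow> 'a::euclidean_space" and \<Phi> :: "'i \<Rightarrow> 'x \<Rightarrow> real"
  assumes G: "\<And>k. L2 M (G k)" and \<Phi>: "\<And>i. L2 M (\<Phi> i)"
    and K: "\<And>k. (\<integral>x. (norm (G k x))\<^sup>2 \<partial>M) \<le> K"
    and lim: "\<And>i. (\<lambda>k. \<integral>x. \<Phi> i x *\<^sub>R G k x \<partial>M) \<longlonglongrightarrow> D i"
  obtains g where "L2 M g" "\<And>i. (\<integral>x. \<Phi> i x *\<^sub>R g x \<partial>M) = D i"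
    "ennreal (\<integral>x. (norm (g x))\<^sup>2 \<partial>M) \<le> liminf (\<lambda>k. ennreal (\<integral>x. (norm (G k x))\<^sup>2 \<partial>M))"
proof -
  define Q where "Q H = (\<integral>x. (norm (H x))\<^sup>2 \<partial>M)" for H :: "'x \<Rightarrow> 'a"
  have Q_nonneg: "Q H \<ge> 0" for H by (simp add: Q_def)
  \<comment> \<open>The condition bounds the error of \<open>H\<close> in pairing \<open>i\<close>
    by every bound valid for all \<open>G k\<close> with \<open>k \<ge> n\<close>, hence by the
    supremum of those errors, which tends to 0. Quantifying over \<open>r\<close> avoids naming the
    supremum and makes convexity and inclusion of the tail immediate.\<close>
  define C where "C n = {H. L2 M H \<and> (\<forall>i r. (\<forall>k\<ge>n. norm ((\<integral>x. \<Phi> i x *\<^sub>R G k x \<partial>M) - D i) \<le> r) \<longrightarrow>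
      norm ((\<integral>x. \<Phi> i x *\<^sub>R H x \<partial>M) - D i) \<le> r)}" for n
  have GC: "G k \<in> C n" if "k \<ge> n" for k n using that G by (auto simp: C_def)
  have CL2: "L2 M H" if "H \<in> C n" for H n using that by (simp add: C_def)
  have C_mono: "C m \<subseteq> C n" if "n \<le> m" for m n using that by (auto simp: C_def)
  have C_mid: "(\<lambda>x. (1/2) *\<^sub>R (H x + H' x)) \<in> C n" if H: "H \<in> C n" "H' \<in> C n" for n H H'
    unfolding C_def
  proof (safe, goal_cases)
    case 1
    show ?case using H by (intro L2_scaleR L2_add CL2)
  next
    case (2 i r)
    have "(\<integral>x. \<Phi> i x *\<^sub>R ((1/2) *\<^sub>R (H x + H' x)) \<partial>M) = (\<integral>x. (1/2) *\<^sub>R (\<Phi> i x *\<^sub>R H x + \<Phi> i x *\<^sub>R H' x) \<partial>M)"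
      by (simp add: scaleR_add_right)
    also have "\<dots> = (1/2) *\<^sub>R ((\<integral>x. \<Phi> i x *\<^sub>R H x \<partial>M) + (\<integral>x. \<Phi> i x *\<^sub>R H' x \<partial>M))"
      using L2_mult_integrable[OF \<Phi> CL2[OF H(1)]] L2_mult_integrable[OF \<Phi> CL2[OF H(2)]]
      by (subst Bochner_Integration.integral_scaleR_right, subst Bochner_Integration.integral_add) auto
    finally have eq: "(\<integral>x. \<Phi> i x *\<^sub>R ((1/2) *\<^sub>R (H x + H' x)) \<partial>M) - D i =
        (1/2) *\<^sub>R (((\<integral>x. \<Phi> i x *\<^sub>R H x \<partial>M) - D i) + ((\<integral>x. \<Phi> i x *\<^sub>R H' x \<partial>M) - D i))"
      by (simp add: algebra_simps flip: scaleR_2)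
    have "norm ((\<integral>x. \<Phi> i x *\<^sub>R H x \<partial>M) - D i) \<le> r" "norm ((\<integral>x. \<Phi> i x *\<^sub>R H' x \<partial>M) - D i) \<le> r"
      using H 2 unfolding C_def by blast+
    then have "norm (((\<integral>x. \<Phi> i x *\<^sub>R H x \<partial>M) - D i) + ((\<integral>x. \<Phi> i x *\<^sub>R H' x \<partial>M) - D i)) \<le> r + r"
      by (rule norm_triangle_mono)
    then show ?case unfolding eq norm_scaleR by simp
  qed
  \<comment> \<open>The sets shrink, so the infima increase; the tail of \<open>G\<close> inside
    each set keeps them below \<open>K\<close>. Hence they converge.\<close>
  define d where "d n = Inf (Q ` C n)" for n
  have bdd: "bdd_below (Q ` C n)" for n by (intro bdd_belowI[of _ 0]) (auto simp: Q_nonneg)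
  have d_le: "d n \<le> Q H" if "H \<in> C n" for H n
    unfolding d_def using that bdd by (intro cInf_lower) auto
  have d_mono: "d n \<le> d m" if "n \<le> m" for n m
    unfolding d_def using C_mono[OF that] GC[of m m] by (intro cInf_superset_mono bdd) auto
  have "incseq d" by (simp add: d_mono incseq_def)
  moreover have "d n \<le> K" for n using d_le[OF GC[of n n]] K[of n] by (simp add: Q_def)
  ultimately obtain dl where dl: "d \<longlonglongrightarrow> dl" "\<And>n. d n \<le> dl"
    using incseq_convergent by blast
  have "\<exists>H. H \<in> C n \<and> Q H < d n + inverse (real (Suc n))" for n
    using cInf_lessD[of "Q ` C n" "d n + inverse (real (Suc n))"] GC[of n n] unfolding d_def[symmetric] by auto
  then obtain h where hC: "\<And>n. h n \<in> C n" and hQ: "\<And>n. Q (h n) < d n + inverse (real (Suc n))"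
    by metis
  have hL2: "L2 M (h n)" for n using CL2[OF hC] .
  \<comment> \<open>The midpoint lies in \<open>C n\<close>, so its \<open>Q\<close> is at least
    \<open>d n\<close>. The parallelogram law then leaves only the gap \<open>dl - d n\<close> and
    the slack of the near-minimizers.\<close>
  have parallelogram: "Q (\<lambda>x. h m x - h n x) \<le> 2 * (dl - d n) + 4 * inverse (real (Suc n))" if "n \<le> m" for n m
  proof -
    have hm: "h m \<in> C n" using hC C_mono[OF that] by auto
    let ?mid = "\<lambda>x. (1/2) *\<^sub>R (h m x + h n x)"
    have mid: "d n \<le> Q ?mid" by (intro d_le C_mid hm hC)
    have "Q (\<lambda>x. h m x - h n x) + 4 * Q ?mid = (\<integral>x. (norm (h m x - h n x))\<^sup>2 + 4 * (norm (?mid x))\<^sup>2 \<partial>M)"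
      unfolding Q_def using L2_integrable[OF L2_diff[OF hL2 hL2, of m n]] L2_integrable[OF CL2[OF C_mid[OF hm hC]]]
      by simp
    also have "\<dots> = (\<integral>x. 2 * (norm (h m x))\<^sup>2 + 2 * (norm (h n x))\<^sup>2 \<partial>M)"
      using parallelogram_law by (intro Bochner_Integration.integral_cong refl) (simp add: power_divide add.commute)
    also have "\<dots> = 2 * Q (h m) + 2 * Q (h n)"
      unfolding Q_def using L2_integrable[OF hL2] by simp
    finally have "Q (\<lambda>x. h m x - h n x) \<le> 2 * Q (h m) + 2 * Q (h n) - 4 * d n"
      using mid by linarith
    moreover have "Q (h m) \<le> dl + inverse (real (Suc n))"
    proof -
      have "inverse (real (Suc m)) \<le> inverse (real (Suc n))" using that by simp
      then show ?thesis using hQ[of m] dl(2)[of m] by linarith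
    qed
    moreover have "Q (h n) \<le> d n + inverse (real (Suc n))" using hQ[of n] by simp
    ultimately have "Q (\<lambda>x. h m x - h n x) \<le> 2 * (dl + inverse (real (Suc n))) + 2 * (d n + inverse (real (Suc n))) - 4 * d n"
      by (meson add_mono diff_mono mult_left_mono order_trans order_refl zero_le_numeral)
    then show ?thesis by (simp add: algebra_simps)
  qed
  have "(\<lambda>n. 2 * (dl - d n) + 4 * inverse (real (Suc n))) \<longlonglongrightarrow> 2 * (dl - dl) + 4 * 0"
    by (intro tendsto_intros dl LIMSEQ_inverse_real_of_nat)
  then have small: "(\<lambda>n. 2 * (dl - d n) + 4 * inverse (real (Suc n))) \<longlonglongrightarrow> 0" by simp
  obtain g where g: "L2 M g" and g_lim: "(\<lambda>n. \<integral>x. (norm (g x - h n x))\<^sup>2 \<partial>M) \<longlonglongrightarrow> 0"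
  proof (rule L2_complete[OF hL2])
    fix e :: real assume "e > 0"
    then obtain N where "\<And>n. n \<ge> N \<Longrightarrow> 2 * (dl - d n) + 4 * inverse (real (Suc n)) < e"
      using order_tendstoD(2)[OF small, of e] by (auto simp: eventually_sequentially)
    then show "\<exists>N. \<forall>n\<ge>N. \<forall>m\<ge>n. (\<integral>x. (norm (h m x - h n x))\<^sup>2 \<partial>M) < e"
      using parallelogram unfolding Q_def by (meson le_less_trans)
  qed
  show ?thesis
  proof
    show "L2 M g" by fact
    show "(\<integral>x. \<Phi> i x *\<^sub>R g x \<partial>M) = D i" for i
    proof (rule LIMSEQ_unique)
      show "(\<lambda>n. \<integral>x. \<Phi> i x *\<^sub>R h n x \<partial>M) \<longlonglongrightarrow> (\<integral>x. \<Phi> i x *\<^sub>R g x \<partial>M)"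
        by (rule L2_tendsto_integral[OF \<Phi> hL2 g g_lim])
      show "(\<lambda>n. \<integral>x. \<Phi> i x *\<^sub>R h n x \<partial>M) \<longlonglongrightarrow> D i"
      proof (rule LIMSEQ_I)
        fix r :: real assume "r > 0"
        then obtain N where N: "\<And>k. k \<ge> N \<Longrightarrow> norm ((\<integral>x. \<Phi> i x *\<^sub>R G k x \<partial>M) - D i) < r / 2"
          using LIMSEQ_D[OF lim[of i], of "r / 2"] by auto
        have "norm ((\<integral>x. \<Phi> i x *\<^sub>R h n x \<partial>M) - D i) \<le> r / 2" if "n \<ge> N" for n
        proof -
          have "\<forall>k\<ge>n. norm ((\<integral>x. \<Phi> i x *\<^sub>R G k x \<partial>M) - D i) \<le> r / 2"
            using N that by (meson le_trans less_imp_le)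
          then show ?thesis using hC[of n] unfolding C_def by blast
        qed
        moreover have "r / 2 < r" using \<open>r > 0\<close> by simp
        ultimately show "\<exists>N. \<forall>n\<ge>N. norm ((\<integral>x. \<Phi> i x *\<^sub>R h n x \<partial>M) - D i) < r"
          by (meson le_less_trans)
      qed
    qed
    have "(\<lambda>n. Q (h n)) \<longlonglongrightarrow> dl"
    proof (rule tendsto_sandwich)
      show "\<forall>\<^sub>F n in sequentially. d n \<le> Q (h n)" using d_le hC by auto
      show "\<forall>\<^sub>F n in sequentially. Q (h n) \<le> d n + inverse (real (Suc n))"
        using hQ by (auto intro!: less_imp_le always_eventually)
      show "d \<longlonglongrightarrow> dl" by fact
      have "(\<lambda>n. d n + inverse (real (Suc n))) \<longlonglongrightarrow> dl + 0"
        by (intro tendsto_intros dl LIMSEQ_inverse_real_of_nat)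
      then show "(\<lambda>n. d n + inverse (real (Suc n))) \<longlonglongrightarrow> dl" by simp
    qed
    then have "(\<integral>x. (norm (g x))\<^sup>2 \<partial>M) \<le> dl"
      using L2_norm_le_limit[OF hL2 g g_lim] by (simp add: Q_def)
    then have "ennreal (\<integral>x. (norm (g x))\<^sup>2 \<partial>M) \<le> ennreal dl" by (rule ennreal_leI)
    \<comment> \<open>Since \<open>G n\<close> belongs to \<open>C n\<close>, \<open>d n\<close> is
      at most its squared norm with the same index; this carries the limit of the minima below the
      liminf.\<close>
    also have "\<dots> = liminf (\<lambda>n. ennreal (d n))"
      using dl(1) by (intro lim_imp_Liminf[symmetric] tendsto_intros) auto
    also have "\<dots> \<le> liminf (\<lambda>n. ennreal (\<integral>x. (norm (G n x))\<^sup>2 \<partial>M))"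
      using d_le[OF GC] by (intro Liminf_mono always_eventually allI ennreal_leI) (simp add: Q_def)
    finally show "ennreal (\<integral>x. (norm (g x))\<^sup>2 \<partial>M) \<le> liminf (\<lambda>k. ennreal (\<integral>x. (norm (G k x))\<^sup>2 \<partial>M))" .
  qed
qed

section \<open>Weak derivatives and the energy\<close>

lemma weak_deriv_absolutely_integrable:
  "weak_deriv_L2loc U g \<Longrightarrow> g absolutely_integrable_on {a..b}"
  by (simp add: weak_deriv_L2loc_def)

lemma weak_deriv_integrable: "weak_deriv_L2loc U g \<Longrightarrow> g integrable_on {a..b}"
  by (intro set_lebesgue_integral_eq_integral weak_deriv_absolutely_integrable)

lemma weak_deriv_integral:
  "weak_deriv_L2loc U g \<Longrightarrow> a \<le> b \<Longrightarrow> integral {a..b} g = U b - U a"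
  by (simp add: weak_deriv_L2loc_def)

text \<open>Absolute integrability on intervals makes the truncations Lebesgue measurable, and
  \<open>g\<close> is their pointwise limit. Borel measurability is not obtained, so the estimates
  are carried out over \<open>lebesgue\<close> although \<open>Ec\<close> integrates over
  \<open>lborel\<close>.\<close>

lemma weak_deriv_measurable:
  fixes g :: "real \<Rightarrow> 'a::euclidean_space"
  assumes "weak_deriv_L2loc U g"
  shows "g \<in> borel_measurable lebesgue"
proof (rule borel_measurable_LIMSEQ_metric)
  show "(\<lambda>x. indicat_real {- real n..real n} x *\<^sub>R g x) \<in> borel_measurable lebesgue" for n
    using weak_deriv_absolutely_integrable[OF assms, of "- real n" "real n"]
    unfolding set_integrable_def by (rule borel_measurable_integrable)
  fix x :: real
  obtain N where "\<bar>x\<bar> \<le> real N" using real_arch_simple by blast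
  then have "\<forall>\<^sub>F n in sequentially. indicat_real {- real n..real n} x *\<^sub>R g x = g x"
    unfolding eventually_sequentially by (intro exI[of _ N]) (auto simp: indicator_def)
  then show "(\<lambda>n. indicat_real {- real n..real n} x *\<^sub>R g x) \<longlonglongrightarrow> g x"
    by (rule tendsto_eventually)
qed

text \<open>\<open>wderiv\<close> is picked by \<open>SOME\<close>, so the energy must not depend on
  the choice. The difference of two candidates integrates to 0 over every interval, and Lebesgue
  differentiation (\<open>integrable_ccontinuous_explicit\<close>) forces it to vanish almost
  everywhere.\<close>

lemma weak_deriv_unique:
  fixes g1 g2 :: "real \<Rightarrow> 'a::euclidean_space"
  assumes "weak_deriv_L2loc U g1" "weak_deriv_L2loc U g2"
  shows "AE x in lebesgue. g1 x = g2 x"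
proof -
  note int = assms[THEN weak_deriv_integrable]
  define f where "f x = g1 x - g2 x" for x
  have f_int: "f integrable_on cbox a b" for a b
    unfolding f_def using int by (simp add: integrable_diff)
  have f_zero: "integral (cbox a b) f = 0" for a b
  proof (cases "a \<le> b")
    case True
    then show ?thesis
      unfolding f_def using int assms[THEN weak_deriv_integral, OF True] by (simp add: integral_diff)
  qed simp
  obtain N where N: "negligible N"
    and Nf: "\<And>x e. \<lbrakk>x \<notin> N; 0 < e\<rbrakk> \<Longrightarrow> \<exists>d>0. \<forall>h. 0 < h \<and> h < d \<longrightarrow>
      norm (integral (cbox x (x + h *\<^sub>R One)) f /\<^sub>R h ^ DIM(real) - f x) < e"
    using integrable_ccontinuous_explicit[of f] f_int by blast
  have "f x = 0" if x: "x \<notin> N" for x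
  proof (rule ccontr)
    assume "f x \<noteq> 0"
    then obtain d where "d > 0"
      "\<And>h. 0 < h \<Longrightarrow> h < d \<Longrightarrow> norm (integral (cbox x (x + h *\<^sub>R One)) f /\<^sub>R h ^ DIM(real) - f x) < norm (f x)"
      using Nf[OF x, of "norm (f x)"] by auto
    from this(2)[of "d / 2"] \<open>d > 0\<close> show False unfolding f_zero by simp
  qed
  moreover have "AE x in lebesgue. x \<notin> N"
    using N by (intro AE_not_in) (simp add: negligible_iff_null_sets)
  ultimately show ?thesis by (auto simp: f_def elim!: eventually_mono)
qed

lemma weak_deriv_continuous:
  fixes U :: "real \<Rightarrow> 'a::euclidean_space"
  assumes "weak_deriv_L2loc U g"
  shows "continuous_on UNIV U"
  unfolding continuous_on_eq_continuous_at[OF open_UNIV]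
proof
  fix x :: real
  have "continuous_on {x-1..x+1} (\<lambda>y. U (x-1) + integral {x-1..y} g)"
    by (intro continuous_intros indefinite_integral_continuous_1 weak_deriv_integrable[OF assms])
  then have "continuous_on {x-1..x+1} U"
    by (rule continuous_on_eq) (simp add: weak_deriv_integral[OF assms])
  then show "isCont U x" by (rule continuous_on_interior) simp
qed

lemma H1loc_wderiv: "H1loc U \<Longrightarrow> weak_deriv_L2loc U (wderiv U)"
  unfolding H1loc_def wderiv_def by (metis someI)

section \<open>Reduction of the energy to a nonnegative functional\<close>

text \<open>The positive part of \<open>f\<close> plus \<open>R\<close> equals \<open>f + R\<close>
  plus the negative part of \<open>f\<close>. That negative part is at most \<open>R\<close>, so
  both subtracted integrals are finite and the identity can be rearranged even if the other two are
  infinite.\<close>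

lemma enn2ereal_diff_shift:
  fixes f R :: "'x \<Rightarrow> real"
  assumes [measurable]: "f \<in> borel_measurable M" "R \<in> borel_measurable M"
    and R: "\<And>x. R x \<ge> 0" and fR: "\<And>x. f x + R x \<ge> 0" and fin: "(\<integral>\<^sup>+x. ennreal (R x) \<partial>M) < \<infinity>"
  shows "enn2ereal (\<integral>\<^sup>+x. ennreal (f x) \<partial>M) - enn2ereal (\<integral>\<^sup>+x. ennreal (- f x) \<partial>M)
    = enn2ereal (\<integral>\<^sup>+x. ennreal (f x + R x) \<partial>M) - enn2ereal (\<integral>\<^sup>+x. ennreal (R x) \<partial>M)"
proof -
  have "ennreal (f x) + ennreal (R x) = ennreal (f x + R x) + ennreal (- f x)" for x
  proof (cases "f x \<ge> 0")
    case True then show ?thesis using R[of x] by (simp add: ennreal_neg)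
  next
    case False then show ?thesis using R[of x] fR[of x]
      by (simp add: ennreal_neg flip: ennreal_plus)
  qed
  then have "(\<integral>\<^sup>+x. ennreal (f x) \<partial>M) + (\<integral>\<^sup>+x. ennreal (R x) \<partial>M)
      = (\<integral>\<^sup>+x. ennreal (f x + R x) \<partial>M) + (\<integral>\<^sup>+x. ennreal (- f x) \<partial>M)"
    by (simp flip: nn_integral_add)
  moreover have "(\<integral>\<^sup>+x. ennreal (- f x) \<partial>M) \<le> (\<integral>\<^sup>+x. ennreal (R x) \<partial>M)"
  proof (intro nn_integral_mono ennreal_leI)
    show "- f x \<le> R x" for x using fR[of x] by linarith
  qed
  ultimately have *: "enn2ereal (\<integral>\<^sup>+x. ennreal (f x) \<partial>M) + enn2ereal (\<integral>\<^sup>+x. ennreal (R x) \<partial>M)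
      = enn2ereal (\<integral>\<^sup>+x. ennreal (f x + R x) \<partial>M) + enn2ereal (\<integral>\<^sup>+x. ennreal (- f x) \<partial>M)"
    "(\<integral>\<^sup>+x. ennreal (- f x) \<partial>M) < \<infinity>"
    using fin by (auto simp flip: plus_ennreal.rep_eq intro: le_less_trans)
  obtain r n where "(\<integral>\<^sup>+x. ennreal (R x) \<partial>M) = ennreal r" "(\<integral>\<^sup>+x. ennreal (- f x) \<partial>M) = ennreal n" "r \<ge> 0" "n \<ge> 0"
    using fin *(2) by (metis ennreal_cases infinity_ennreal_def less_irrefl)
  with *(1) show ?thesis
    by (cases "enn2ereal (\<integral>\<^sup>+x. ennreal (f x) \<partial>M)"; cases "enn2ereal (\<integral>\<^sup>+x. ennreal (f x + R x) \<partial>M)") auto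
qed

text \<open>Positivity of \<open>c\<close> makes the weight integrable at minus infinity, which
  keeps the shift of the energy finite. A reflection leads to the standard integral of a decaying
  exponential.\<close>

lemma nn_integral_exp_left:
  fixes c L m :: real
  assumes "c > 0" "m \<ge> 0"
  shows "(\<integral>\<^sup>+x. ennreal ((if x < L then m else 0) * exp (c * x)) \<partial>lebesgue) < \<infinity>"
proof -
  have "(\<integral>\<^sup>+x. ennreal ((if x < L then m else 0) * exp (c * x)) \<partial>lebesgue)
      = (\<integral>\<^sup>+x. ennreal ((if x < L then m else 0) * exp (c * x)) \<partial>lborel)"
    by (rule nn_integral_completion)
  also have "\<dots> = (\<integral>\<^sup>+x. ennreal ((if -x < L then m else 0) * exp (- c * x)) \<partial>lborel)"
    by (subst nn_integral_real_affine[where c = "-1" and t = 0]) auto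
  also have "\<dots> \<le> (\<integral>\<^sup>+x. ennreal m * (ennreal (exp (- c * x)) * indicator {-L..} x) \<partial>lborel)"
    using assms by (intro nn_integral_mono) (auto simp: indicator_def ennreal_mult)
  also have "\<dots> = ennreal m * (\<integral>\<^sup>+x. ennreal (exp (- c * x)) * indicator {-L..} x \<partial>lborel)"
    by (rule nn_integral_cmult) measurable
  also have "\<dots> = ennreal m * ennreal (exp (- c * - L) / c)"
    by (subst nn_integral_has_integral_lebesgue'[OF _ has_integral_exp_minus_to_infinity[OF assms(1)]]) auto
  also have "\<dots> < \<infinity>" by (simp add: ennreal_mult_less_top)
  finally show ?thesis .
qed

text \<open>Suprema of increasing sequences add in \<open>ennreal\<close>, and infima over a tail
  are superadditive. This allows lower semicontinuity to be proved separately for the two parts of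
  the energy.\<close>

lemma ennreal_liminf_add_le:
  fixes a b :: "nat \<Rightarrow> ennreal"
  shows "liminf a + liminf b \<le> liminf (\<lambda>n. a n + b n)"
proof -
  have inc: "incseq (\<lambda>n. INF k\<in>{n..}. u k)" for u :: "nat \<Rightarrow> ennreal"
    by (intro incseq_SucI INF_superset_mono) auto
  have "liminf a + liminf b = (SUP n. (INF k\<in>{n..}. a k) + (INF k\<in>{n..}. b k))"
    unfolding liminf_SUP_INF by (rule ennreal_SUP_add[symmetric, OF inc inc])
  also have "\<dots> \<le> (SUP n. INF k\<in>{n..}. a k + b k)"
    by (intro SUP_mono' INF_greatest add_mono INF_lower)
  finally show ?thesis by (simp add: liminf_SUP_INF)
qed

text \<open>The argument is the derivative rather than \<open>U\<close>, because the derivative of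
  the limit arises from a weak limit and need not be the chosen \<open>wderiv\<close>.\<close>

definition kinetic :: "real \<Rightarrow> (real \<Rightarrow> 'a::euclidean_space) \<Rightarrow> ennreal" where
  "kinetic c g = (\<integral>\<^sup>+x. ennreal (1/2 * (norm (g x))\<^sup>2 * exp (c * x)) \<partial>lebesgue)"

text \<open>Subtracting \<^term>\<open>m\<close>, the minimum of \<^term>\<open>W\<close>, on the left half-line makes the integrand
  nonnegative and changes the energy only by a finite constant.\<close>
definition potential :: "real \<Rightarrow> ('a::euclidean_space \<Rightarrow> real) \<Rightarrow> real \<Rightarrow> real \<Rightarrow> (real \<Rightarrow> 'a) \<Rightarrow> ennreal" where
  "potential c W m L U = (\<integral>\<^sup>+x. ennreal ((W (U x) - (if x < L then m else 0)) * exp (c * x)) \<partial>lebesgue)"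

text \<open>The weight and the factor \<open>1/2\<close> are absorbed, so that the kinetic energy is an unweighted squared
  norm of \<open>weighted c g\<close>, whose pairing with \<open>window c a b\<close> is the integral of \<open>g\<close> over \<open>[a, b]\<close>.\<close>
definition weighted :: "real \<Rightarrow> (real \<Rightarrow> 'a::euclidean_space) \<Rightarrow> real \<Rightarrow> 'a" where
  "weighted c g x = (exp (c * x / 2) / sqrt 2) *\<^sub>R g x"

definition window :: "real \<Rightarrow> real \<Rightarrow> real \<Rightarrow> real \<Rightarrow> real" where
  "window c a b x = sqrt 2 * exp (- c * x / 2) * indicator {a..b} x"

lemma measurable_ident_lebesgue [measurable]: "(\<lambda>x::real. x) \<in> borel_measurable lebesgue"
  by (rule measurable_completion) simp

text \<open>The subtracted constant does not involve \<open>U\<close>, so minimizing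
  \<open>Ec\<close> amounts to minimizing \<open>kinetic\<close> plus \<open>potential\<close>, with
  any weak derivative \<open>g\<close> inserted.\<close>

lemma Ec_eq:
  fixes U :: "real \<Rightarrow> 'a::euclidean_space"
  assumes W: "continuous_on UNIV W" and g: "weak_deriv_L2loc U g"
    and m: "\<And>u. m \<le> W u" "m \<le> 0" and pos: "\<And>x. x \<ge> L \<Longrightarrow> W (U x) \<ge> 0" and c: "c > 0"
  shows "Ec c W U = enn2ereal (kinetic c g + potential c W m L U)
    - enn2ereal (\<integral>\<^sup>+x. ennreal ((if x < L then - m else 0) * exp (c * x)) \<partial>lebesgue)"
proof -
  have wd: "weak_deriv_L2loc U (wderiv U)"
    using g by (intro H1loc_wderiv) (auto simp: H1loc_def)
  define f where "f x = (1/2 * (norm (wderiv U x))\<^sup>2 + W (U x)) * exp (c * x)" for x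
  define R where "R x = (if x < L then - m else 0) * exp (c * x)" for x
  have [measurable]: "wderiv U \<in> borel_measurable lebesgue" by (rule weak_deriv_measurable[OF wd])
  have "continuous_on UNIV (\<lambda>x. W (U x))"
    by (rule continuous_on_compose2[OF W weak_deriv_continuous[OF g]]) auto
  then have [measurable]: "(\<lambda>x. W (U x)) \<in> borel_measurable lebesgue"
    by (intro measurable_completion) (simp add: borel_measurable_continuous_onI)
  have [measurable]: "f \<in> borel_measurable lebesgue" unfolding f_def by measurable
  have [measurable]: "R \<in> borel_measurable lebesgue"
    unfolding R_def by measurable
  have R_nonneg: "R x \<ge> 0" for x using m by (simp add: R_def)
  \<comment> \<open>Left of \<open>L\<close> the global bound \<open>m\<close> is subtracted; from
    \<open>L\<close> on, \<open>pos\<close> already gives the sign.\<close>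
  have shift_nonneg: "W (U x) - (if x < L then m else 0) \<ge> 0" for x using m pos[of x] by auto
  have fR: "f x + R x = 1/2 * (norm (wderiv U x))\<^sup>2 * exp (c * x) + (W (U x) - (if x < L then m else 0)) * exp (c * x)" for x
    by (simp add: f_def R_def algebra_simps)
  have "f x + R x \<ge> 0" for x
    unfolding fR using shift_nonneg[of x] by (intro add_nonneg_nonneg mult_nonneg_nonneg) auto
  moreover have "(\<integral>\<^sup>+x. ennreal (R x) \<partial>lebesgue) < \<infinity>"
    unfolding R_def by (rule nn_integral_exp_left) (use c m in auto)
  ultimately have "enn2ereal (\<integral>\<^sup>+x. ennreal (f x) \<partial>lebesgue) - enn2ereal (\<integral>\<^sup>+x. ennreal (- f x) \<partial>lebesgue)
    = enn2ereal (\<integral>\<^sup>+x. ennreal (f x + R x) \<partial>lebesgue) - enn2ereal (\<integral>\<^sup>+x. ennreal (R x) \<partial>lebesgue)"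
    by (intro enn2ereal_diff_shift R_nonneg) auto
  moreover have "(\<integral>\<^sup>+x. ennreal (f x + R x) \<partial>lebesgue) = kinetic c (wderiv U) + potential c W m L U"
  proof -
    have "(\<integral>\<^sup>+x. ennreal (f x + R x) \<partial>lebesgue) = (\<integral>\<^sup>+x. ennreal (1/2 * (norm (wderiv U x))\<^sup>2 * exp (c * x))
       + ennreal ((W (U x) - (if x < L then m else 0)) * exp (c * x)) \<partial>lebesgue)"
      unfolding fR using shift_nonneg by (intro nn_integral_cong ennreal_plus mult_nonneg_nonneg) auto
    also have "\<dots> = kinetic c (wderiv U) + potential c W m L U"
      unfolding kinetic_def potential_def by (rule nn_integral_add) measurable
    finally show ?thesis .
  qed
  moreover have "kinetic c (wderiv U) = kinetic c g"
    unfolding kinetic_def using weak_deriv_unique[OF wd g]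
    by (intro nn_integral_cong_AE) (auto elim!: eventually_mono)
  ultimately show ?thesis
    \<comment> \<open>Passing to the completion leaves nonnegative integrals unchanged, which
      bridges \<open>lborel\<close> in \<open>Ec\<close> and \<open>lebesgue\<close> here.\<close>
    unfolding Ec_def Let_def f_def R_def nn_integral_completion by simp
qed

section \<open>Hoelder estimate, compactness and weak limits of derivatives\<close>

lemma weighted_norm_sq: "(norm (weighted c g x))\<^sup>2 = 1/2 * (norm (g x))\<^sup>2 * exp (c * x)"
  by (simp add: weighted_def power_mult_distrib power_divide flip: exp_double)

lemma window_scaleR_weighted: "window c a b x *\<^sub>R weighted c g x = indicator {a..b} x *\<^sub>R g x"
  by (simp add: window_def weighted_def flip: exp_add)

lemma
  assumes "c > 0"
  shows L2_window: "L2 lebesgue (window c a b)"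
    and window_sq_integral_le: "a \<le> b \<Longrightarrow> (\<integral>x. (window c a b x)\<^sup>2 \<partial>lebesgue) \<le> 2 * exp (- c * a) * (b - a)"
proof -
  have [measurable]: "window c a b \<in> borel_measurable lebesgue"
    unfolding window_def by measurable
  have int: "integrable lebesgue (\<lambda>x. 2 * exp (- c * a) * indicator {a..b} x)"
    by (intro integrable_mult_right integrable_real_indicator) (auto simp: emeasure_lborel_Icc_eq)
  have le: "(window c a b x)\<^sup>2 \<le> 2 * exp (- c * a) * indicator {a..b} x" for x
    using assms by (auto simp: window_def power_mult_distrib indicator_def simp flip: exp_double)
  have int_sq: "integrable lebesgue (\<lambda>x. (window c a b x)\<^sup>2)"
    using int by (rule Bochner_Integration.integrable_bound) (use le in \<open>auto intro!: AE_I2 order_trans[OF _ abs_ge_self]\<close>)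
  then show "L2 lebesgue (window c a b)" by (simp add: L2_def)
  assume "a \<le> b"
  have "(\<integral>x. (window c a b x)\<^sup>2 \<partial>lebesgue) \<le> (\<integral>x. 2 * exp (- c * a) * indicator {a..b} x \<partial>lebesgue)"
    by (intro integral_mono int int_sq le)
  also have "\<dots> = 2 * exp (- c * a) * (b - a)"
    using \<open>a \<le> b\<close> by simp
  finally show "(\<integral>x. (window c a b x)\<^sup>2 \<partial>lebesgue) \<le> 2 * exp (- c * a) * (b - a)" .
qed

lemma
  fixes U :: "real \<Rightarrow> 'a::euclidean_space"
  assumes g: "weak_deriv_L2loc U g" and K: "kinetic c g \<le> ennreal K" "K \<ge> 0"
  shows L2_weighted: "L2 lebesgue (weighted c g)"
    and kinetic_eq_weighted: "kinetic c g = ennreal (\<integral>x. (norm (weighted c g x))\<^sup>2 \<partial>lebesgue)"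
    and weighted_sq_integral_le: "(\<integral>x. (norm (weighted c g x))\<^sup>2 \<partial>lebesgue) \<le> K"
proof -
  have [measurable]: "g \<in> borel_measurable lebesgue" by (rule weak_deriv_measurable[OF g])
  have [measurable]: "weighted c g \<in> borel_measurable lebesgue"
    unfolding weighted_def by measurable
  have nn: "(\<integral>\<^sup>+x. ennreal ((norm (weighted c g x))\<^sup>2) \<partial>lebesgue) = kinetic c g"
    unfolding weighted_norm_sq kinetic_def ..
  then show L2: "L2 lebesgue (weighted c g)"
    unfolding L2_def using le_less_trans[OF K(1)] by (auto intro!: integrableI_bounded)
  from L2_nn_integral[OF this] show eq: "kinetic c g = ennreal (\<integral>x. (norm (weighted c g x))\<^sup>2 \<partial>lebesgue)"
    by (simp add: nn)
  show "(\<integral>x. (norm (weighted c g x))\<^sup>2 \<partial>lebesgue) \<le> K"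
    using K unfolding eq by (simp add: ennreal_le_iff)
qed

lemma integral_window_weighted:
  fixes U :: "real \<Rightarrow> 'a::euclidean_space"
  assumes "weak_deriv_L2loc U g" "a \<le> b"
  shows "(\<integral>x. window c a b x *\<^sub>R weighted c g x \<partial>lebesgue) = U b - U a"
proof -
  have "(\<integral>x. window c a b x *\<^sub>R weighted c g x \<partial>lebesgue) = (LINT x:{a..b}|lebesgue. g x)"
    unfolding window_scaleR_weighted set_lebesgue_integral_def ..
  also have "\<dots> = integral {a..b} g"
    using weak_deriv_absolutely_integrable[OF assms(1)] by (rule set_lebesgue_integral_eq_integral)
  finally show ?thesis using weak_deriv_integral[OF assms] by simp
qed

text \<open>Cauchy-Schwarz is applied to the increment, written as a pairing with
  \<open>window\<close>. The exponent \<open>\<bar>x\<bar> + \<bar>y\<bar>\<close> majorizes the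
  negative of the left endpoint; it is symmetric, and for fixed \<open>x\<close> the bound tends to
  0 as \<open>y\<close> approaches \<open>x\<close>.\<close>

lemma Holder_half:
  fixes U :: "real \<Rightarrow> 'a::euclidean_space"
  assumes c: "c > 0" and g: "weak_deriv_L2loc U g" and K: "kinetic c g \<le> ennreal K" "K \<ge> 0"
  shows "norm (U x - U y) \<le> sqrt (2 * exp (c * (\<bar>x\<bar> + \<bar>y\<bar>)) * \<bar>x - y\<bar> * K)"
proof -
  have *: "norm (U b - U a) \<le> sqrt (2 * exp (c * (\<bar>a\<bar> + \<bar>b\<bar>)) * \<bar>a - b\<bar> * K)" if ab: "a \<le> b" for a b
  proof (rule real_le_rsqrt)
    have "(norm (U b - U a))\<^sup>2 \<le> (\<integral>x. (window c a b x)\<^sup>2 \<partial>lebesgue) * (\<integral>x. (norm (weighted c g x))\<^sup>2 \<partial>lebesgue)"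
      using L2_Cauchy_Schwarz[OF L2_window[OF c] L2_weighted[OF g K], of a b] unfolding integral_window_weighted[OF g ab] .
    also have "\<dots> \<le> (2 * exp (- c * a) * (b - a)) * K"
      using ab K by (intro mult_mono window_sq_integral_le weighted_sq_integral_le[OF g] c) auto
    also have "\<dots> \<le> (2 * exp (c * (\<bar>a\<bar> + \<bar>b\<bar>)) * \<bar>a - b\<bar>) * K"
    proof (intro mult_right_mono mult_mono)
      have "- a \<le> \<bar>a\<bar> + \<bar>b\<bar>" by simp
      then have "c * (- a) \<le> c * (\<bar>a\<bar> + \<bar>b\<bar>)" using c by (intro mult_left_mono) auto
      then show "exp (- c * a) \<le> exp (c * (\<bar>a\<bar> + \<bar>b\<bar>))" by simp
    qed (use ab K in auto)
    finally show "(norm (U b - U a))\<^sup>2 \<le> 2 * exp (c * (\<bar>a\<bar> + \<bar>b\<bar>)) * \<bar>a - b\<bar> * K" .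
  qed
  show ?thesis
    using *[of x y] *[of y x] by (cases "x \<le> y") (simp_all add: norm_minus_commute abs_minus_commute add.commute)
qed

text \<open>A diagonal argument gives convergence at the rationals, and the common modulus
  \<open>H\<close> carries it to every real by splitting the error into three.\<close>

lemma pointwise_convergent_subsequence:
  fixes U :: "nat \<Rightarrow> real \<Rightarrow> 'a::euclidean_space"
  assumes c: "c > 0" and g: "\<And>k. weak_deriv_L2loc (U k) (g k)"
    and K: "\<And>k. kinetic c (g k) \<le> ennreal K" "K \<ge> 0" and B: "\<And>k. norm (U k z) \<le> B"
  obtains r V where "strict_mono r" "\<And>x. (\<lambda>k. U (r k) x) \<longlonglongrightarrow> V x"
proof -
  define H where "H x y = sqrt (2 * exp (c * (\<bar>x\<bar> + \<bar>y\<bar>)) * \<bar>x - y\<bar> * K)" for x y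
  have H: "norm (U k x - U k y) \<le> H x y" for k x y
    unfolding H_def by (rule Holder_half[OF c g K])
  \<comment> \<open>The value at \<open>z\<close> and the modulus bound all \<open>U k x\<close>;
    adding 1 permits division by \<open>M x\<close>. The diagonal lemma wants one bound for all
    points, hence the normalization by \<open>M\<close> below.\<close>
  define M where "M x = B + H x z + 1" for x
  have "B \<ge> 0" using B[of 0] norm_ge_zero order_trans by blast
  then have M: "M x > 0" for x using K by (auto simp: M_def H_def intro!: add_nonneg_pos)
  have bound: "norm (U k x) \<le> M x" for k x
    using norm_triangle_sub[of "U k x" "U k z"] H[of k x z] B[of k] by (simp add: M_def)
  have "norm (inverse (M x) *\<^sub>R U k x) \<le> 1" for k x
    using bound[of k x] M[of x] by (simp add: field_simps)
  then obtain r where r: "strict_mono r"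
    and conv: "\<And>q. q \<in> \<rat> \<Longrightarrow> \<exists>l. (\<lambda>k. inverse (M q) *\<^sub>R U (r k) q) \<longlonglongrightarrow> l"
    using function_convergent_subsequence[of "\<rat>" "\<lambda>k x. inverse (M x) *\<^sub>R U k x" 1] countable_rat by blast
  have conv_rat: "convergent (\<lambda>k. U (r k) q)" if "q \<in> \<rat>" for q
  proof -
    obtain l where "(\<lambda>k. inverse (M q) *\<^sub>R U (r k) q) \<longlonglongrightarrow> l" using conv \<open>q \<in> \<rat>\<close> by blast
    then have "(\<lambda>k. M q *\<^sub>R (inverse (M q) *\<^sub>R U (r k) q)) \<longlonglongrightarrow> M q *\<^sub>R l"
      by (intro tendsto_intros)
    then show ?thesis using M[of q] by (auto simp: convergent_def)
  qed
  have "convergent (\<lambda>k. U (r k) x)" for x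
  proof (rule Cauchy_convergent, rule metric_CauchyI)
    fix e :: real assume "e > 0"
    have "isCont (H x) x" unfolding H_def by (intro continuous_intros)
    then have "H x \<midarrow>x\<rightarrow> 0" by (simp add: isCont_def H_def)
    then obtain d where d: "d > 0" "\<And>y. y \<noteq> x \<Longrightarrow> dist y x < d \<Longrightarrow> \<bar>H x y\<bar> < e / 3"
      using \<open>e > 0\<close> by (auto dest!: tendstoD[of _ _ _ "e / 3"] simp: eventually_at)
    obtain q where q: "q \<in> \<rat>" "x < q" "q < x + d" using Rats_dense_in_real[of x "x + d"] d by auto
    then have Hq: "H x q < e / 3" using d(2)[of q] by (simp add: dist_real_def)
    have "Cauchy (\<lambda>k. U (r k) q)" by (intro convergent_Cauchy conv_rat q)
    then obtain N where N: "\<And>m n. m \<ge> N \<Longrightarrow> n \<ge> N \<Longrightarrow> dist (U (r m) q) (U (r n) q) < e / 3"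
      using \<open>e > 0\<close> metric_CauchyD[of _ "e / 3"] by (metis divide_pos_pos zero_less_numeral)
    have "dist (U (r m) x) (U (r n) x) < e" if "m \<ge> N" "n \<ge> N" for m n
    proof -
      have "dist (U (r m) x) (U (r n) x) \<le> dist (U (r m) x) (U (r m) q) + dist (U (r m) q) (U (r n) q) + dist (U (r n) x) (U (r n) q)"
        using dist_triangle[of "U (r m) x" "U (r n) x" "U (r m) q"]
          dist_triangle[of "U (r m) q" "U (r n) x" "U (r n) q"] by (simp add: dist_commute)
      then show ?thesis using H[of "r m" x q] H[of "r n" x q] N[OF that] Hq by (simp add: dist_norm)
    qed
    then show "\<exists>N. \<forall>m\<ge>N. \<forall>n\<ge>N. dist (U (r m) x) (U (r n) x) < e" by blast
  qed
  then have "(\<lambda>k. U (r k) x) \<longlonglongrightarrow> lim (\<lambda>k. U (r k) x)" for x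
    by (simp add: convergent_LIMSEQ_iff)
  with r show ?thesis by (rule that)
qed

text \<open>The windows over all pairs of endpoints serve as test functions in
  \<open>L2_weak_limit\<close>: their pairings are increments of \<open>U k\<close> and converge to
  those of \<open>V\<close>.\<close>

lemma weak_deriv_limit:
  fixes U :: "nat \<Rightarrow> real \<Rightarrow> 'a::euclidean_space"
  assumes c: "c > 0" and g: "\<And>k. weak_deriv_L2loc (U k) (g k)"
    and K: "\<And>k. kinetic c (g k) \<le> ennreal K" "K \<ge> 0" and lim: "\<And>x. (\<lambda>k. U k x) \<longlonglongrightarrow> V x"
  obtains h where "weak_deriv_L2loc V h" "kinetic c h \<le> liminf (\<lambda>k. kinetic c (g k))"
proof -
  \<comment> \<open>For reversed endpoints the window vanishes identically, so the limiting pairing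
    is 0.\<close>
  define D where "D i = (if fst i \<le> snd i then V (snd i) - V (fst i) else 0)" for i :: "real \<times> real"
  have D_lim: "(\<lambda>k. \<integral>x. window c (fst i) (snd i) x *\<^sub>R weighted c (g k) x \<partial>lebesgue) \<longlonglongrightarrow> D i" for i
  proof (cases "fst i \<le> snd i")
    case True
    then have "(\<integral>x. window c (fst i) (snd i) x *\<^sub>R weighted c (g k) x \<partial>lebesgue) = U k (snd i) - U k (fst i)" for k
      by (rule integral_window_weighted[OF g])
    then show ?thesis using True by (simp add: D_def tendsto_diff[OF lim lim])
  next
    case False
    then show ?thesis by (simp add: D_def window_def)
  qed
  obtain G where G: "L2 lebesgue G"
    and G_D: "\<And>i. (\<integral>x. window c (fst i) (snd i) x *\<^sub>R G x \<partial>lebesgue) = D i"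
    and G_le: "ennreal (\<integral>x. (norm (G x))\<^sup>2 \<partial>lebesgue) \<le> liminf (\<lambda>k. ennreal (\<integral>x. (norm (weighted c (g k) x))\<^sup>2 \<partial>lebesgue))"
    by (rule L2_weak_limit[where \<Phi> = "\<lambda>i. window c (fst i) (snd i)" and G = "\<lambda>k. weighted c (g k)",
        OF L2_weighted[OF g K] L2_window[OF c] weighted_sq_integral_le[OF g K] D_lim]) (assumption | rule that)+
  \<comment> \<open>Undoing the weight: pairings of \<open>G\<close> with windows become integrals
    of \<open>h\<close>, and the squared norm of \<open>G\<close> becomes the kinetic energy of
    \<open>h\<close>.\<close>
  define h where "h x = (sqrt 2 * exp (- c * x / 2)) *\<^sub>R G x" for x
  have weighted_h: "weighted c h = G" by (rule ext) (simp add: weighted_def h_def flip: exp_add)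
  have ind_h: "indicat_real {a..b} x *\<^sub>R h x = window c a b x *\<^sub>R G x" for a b x
    by (simp flip: weighted_h add: window_scaleR_weighted)
  have abs_int: "h absolutely_integrable_on {a..b}" for a b
    unfolding set_integrable_def ind_h by (intro L2_mult_integrable L2_window c G)
  have sq_int: "(\<lambda>x. (norm (h x))\<^sup>2) integrable_on {a..b}" for a b
  proof (rule set_lebesgue_integral_eq_integral)
    have [measurable]: "G \<in> borel_measurable lebesgue" using G by (rule L2_measurable)
    have [measurable]: "h \<in> borel_measurable lebesgue"
      unfolding h_def by measurable
    show "set_integrable lebesgue {a..b} (\<lambda>x. (norm (h x))\<^sup>2)"
      unfolding set_integrable_def
    proof (rule Bochner_Integration.integrable_bound)
      show "integrable lebesgue (\<lambda>x. 2 * exp (- c * a) * (norm (G x))\<^sup>2)"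
        by (intro integrable_mult_right L2_integrable G)
      have "norm (indicat_real {a..b} x *\<^sub>R (norm (h x))\<^sup>2) \<le> norm (2 * exp (- c * a) * (norm (G x))\<^sup>2)" for x
        using c by (auto simp: h_def indicator_def power_mult_distrib simp flip: exp_double intro!: mult_right_mono)
      then show "AE x in lebesgue. norm (indicat_real {a..b} x *\<^sub>R (norm (h x))\<^sup>2) \<le> norm (2 * exp (- c * a) * (norm (G x))\<^sup>2)"
        by (rule AE_I2)
    qed measurable
  qed
  show ?thesis
  proof
    have "V b - V a = integral {a..b} h" if "a \<le> b" for a b
    proof -
      have "integral {a..b} h = (\<integral>x. window c a b x *\<^sub>R G x \<partial>lebesgue)"
        using set_lebesgue_integral_eq_integral(2)[OF abs_int, of a b]
        unfolding set_lebesgue_integral_def ind_h ..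
      also have "\<dots> = V b - V a" using G_D[of "(a, b)"] that by (simp add: D_def)
      finally show ?thesis ..
    qed
    then show "weak_deriv_L2loc V h"
      unfolding weak_deriv_L2loc_def using abs_int sq_int by blast
    have "kinetic c h = ennreal (\<integral>x. (norm (G x))\<^sup>2 \<partial>lebesgue)"
      unfolding kinetic_def weighted_norm_sq[symmetric] weighted_h by (rule L2_nn_integral[OF G])
    also have "\<dots> \<le> liminf (\<lambda>k. kinetic c (g k))"
      using G_le unfolding kinetic_eq_weighted[OF g K, symmetric] .
    finally show "kinetic c h \<le> liminf (\<lambda>k. kinetic c (g k))" .
  qed
qed

section \<open>Existence of minimizers\<close>

text \<open>Unrelated to \<open>window\<close>: this integrates the step function that is the
  derivative of a ramp. The measure is the length of the overlap of the two intervals, and 0 if they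
  are disjoint.\<close>

lemma has_integral_window:
  fixes w :: "'b::euclidean_space" and a b L :: real
  shows "((\<lambda>x. if x \<in> {-L..L} then w else 0) has_integral (measure lborel {max (-L) a..min L b} *\<^sub>R w)) {a..b}"
  unfolding has_integral_restrict_Int Int_atLeastAtMost by (rule has_integral_const_real)

text \<open>The witness runs linearly from \<open>am\<close> to \<open>ap\<close> over
  \<open>{-L..L}\<close> with slope \<open>v\<close> and is constant outside.\<close>

lemma XL_nonempty:
  fixes am ap :: "'a::euclidean_space"
  assumes "L > 0" "r0 > 0"
  shows "XL L r0 am ap \<noteq> {}"
proof -
  define v where "v = (1 / (2 * L)) *\<^sub>R (ap - am)"
  define U where "U x = am + max 0 (min (2 * L) (x + L)) *\<^sub>R v" for x
  define g where "g x = (if x \<in> {-L..L} then v else 0)" for x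
  have g_int: "(g has_integral (measure lborel {max (-L) a..min L b} *\<^sub>R v)) {a..b}" for a b
    unfolding g_def by (rule has_integral_window)
  have "(\<lambda>x. norm (g x)) = (\<lambda>x. if x \<in> {-L..L} then norm v else 0)"
    "(\<lambda>x. (norm (g x))\<^sup>2) = (\<lambda>x. if x \<in> {-L..L} then (norm v)\<^sup>2 else 0)"
    by (auto simp: g_def)
  then have norm_int: "(\<lambda>x. norm (g x)) integrable_on {a..b}" "(\<lambda>x. (norm (g x))\<^sup>2) integrable_on {a..b}" for a b
    by (simp_all only: has_integral_integrable[OF has_integral_window])
  have "U b - U a = integral {a..b} g" if "a \<le> b" for a b
  proof -
    \<comment> \<open>The clamped coordinate grows by exactly the part of \<open>{a..b}\<close> that
      lies in \<open>{-L..L}\<close>.\<close>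
    have "max 0 (min (2 * L) (b + L)) - max 0 (min (2 * L) (a + L)) = measure lborel {max (-L) a..min L b}"
      using that assms by (auto simp: content_real_if max_def min_def)
    then have "U b - U a = measure lborel {max (-L) a..min L b} *\<^sub>R v"
      by (simp add: U_def flip: scaleR_diff_left)
    then show ?thesis using integral_unique[OF g_int] by simp
  qed
  then have "weak_deriv_L2loc U g"
    using g_int norm_int unfolding weak_deriv_L2loc_def absolutely_integrable_on_def by blast
  moreover have "U x = ap" if "x \<ge> L" for x using that assms by (simp add: U_def v_def)
  moreover have "U x = am" if "x \<le> - L" for x using that assms by (simp add: U_def)
  ultimately have "U \<in> XL L r0 am ap"
    using assms by (auto simp: XL_def H1loc_def)
  then show ?thesis by blast
qed

lemma C2_fun_continuous: "C2_fun W \<Longrightarrow> continuous_on UNIV W"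
  unfolding C2_fun_def by (metis has_derivative_continuous continuous_at_imp_continuous_on)

lemma potential_le_liminf:
  fixes U :: "nat \<Rightarrow> real \<Rightarrow> 'a::euclidean_space"
  assumes W: "continuous_on UNIV W" and U: "\<And>k. continuous_on UNIV (U k)"
    and lim: "\<And>x. (\<lambda>k. U k x) \<longlonglongrightarrow> V x"
  shows "potential c W m L V \<le> liminf (\<lambda>k. potential c W m L (U k))"
proof -
  have [measurable]: "(\<lambda>x. W (U k x)) \<in> borel_measurable lebesgue" for k
    using continuous_on_compose2[OF W U, of k]
    by (intro measurable_completion) (simp add: borel_measurable_continuous_onI)
  have "(\<lambda>k. W (U k x)) \<longlonglongrightarrow> W (V x)" for x
    using W lim by (intro continuous_on_tendsto_compose[OF W]) auto
  then have "(\<lambda>k. ennreal ((W (U k x) - (if x < L then m else 0)) * exp (c * x)))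
      \<longlonglongrightarrow> ennreal ((W (V x) - (if x < L then m else 0)) * exp (c * x))" for x
    by (intro tendsto_intros)
  then have "potential c W m L V = (\<integral>\<^sup>+x. liminf (\<lambda>k. ennreal ((W (U k x) - (if x < L then m else 0)) * exp (c * x))) \<partial>lebesgue)"
    unfolding potential_def by (intro nn_integral_cong lim_imp_Liminf[symmetric]) auto
  also have "\<dots> \<le> liminf (\<lambda>k. potential c W m L (U k))"
    unfolding potential_def by (rule nn_integral_liminf) measurable
  finally show ?thesis .
qed

lemma XL_minimizer:
  fixes W :: "'a::euclidean_space \<Rightarrow> real"
  assumes W: "continuous_on UNIV W" and "L > 0" "r0 > 0" and c: "c > 0"
  obtains V h where "V \<in> XL L r0 am ap" "weak_deriv_L2loc V h"
    "\<And>U. U \<in> XL L r0 am ap \<Longrightarrow> kinetic c h + potential c W m L V \<le> kinetic c (wderiv U) + potential c W m L U"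
proof -
  define X where "X = XL L r0 am ap"
  define J where "J U = kinetic c (wderiv U) + potential c W m L U" for U :: "real \<Rightarrow> 'a"
  have X: "weak_deriv_L2loc U (wderiv U)" if "U \<in> X" for U
    using that by (intro H1loc_wderiv) (simp add: X_def XL_def)
  have "X \<noteq> {}" unfolding X_def by (rule XL_nonempty) fact+
  show ?thesis
  proof (cases "Inf (J ` X) = \<infinity>")
    \<comment> \<open>If the infimum is infinite, every member of the class attains it, so the
      energy of the ramp never has to be estimated.\<close>
    case True
    obtain U where U: "U \<in> X" using \<open>X \<noteq> {}\<close> by blast
    show ?thesis
    proof
      show "U \<in> XL L r0 am ap" "weak_deriv_L2loc U (wderiv U)"
        using U X by (auto simp: X_def)
      fix U' assume "U' \<in> XL L r0 am ap"
      then have "Inf (J ` X) \<le> J U'" by (intro INF_lower) (simp add: X_def)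
      then have "J U' = \<infinity>" using True by (simp add: top_unique)
      then show "kinetic c (wderiv U) + potential c W m L U \<le> kinetic c (wderiv U') + potential c W m L U'"
        unfolding J_def by (simp only: infinity_ennreal_def top_greatest)
    qed
  next
    case False
    obtain u where u: "\<And>n. u n \<in> J ` X" and u_lim: "u \<longlonglongrightarrow> Inf (J ` X)"
      using Inf_as_limit[of "J ` X"] \<open>X \<noteq> {}\<close> by blast
    obtain i where i: "Inf (J ` X) = ennreal i" "i \<ge> 0" using False by (cases "Inf (J ` X)") auto
    \<comment> \<open>The margin 1 is arbitrary. Dropping the first \<open>N\<close> terms makes the
      kinetic bound hold for every index of \<open>U\<close>.\<close>
    have "\<forall>\<^sub>F n in sequentially. u n < ennreal (i + 1)"
      using i by (intro order_tendstoD(2)[OF u_lim]) (simp add: ennreal_lessI)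
    then obtain N where N: "\<And>n. n \<ge> N \<Longrightarrow> u n < ennreal (i + 1)"
      by (auto simp: eventually_sequentially)
    have "\<exists>U. U \<in> X \<and> J U = u (n + N)" for n using u[of "n + N"] by auto
    then obtain U where UX: "\<And>n. U n \<in> X" and JU: "\<And>n. J (U n) = u (n + N)" by metis
    have K: "kinetic c (wderiv (U n)) \<le> ennreal (i + 1)" for n
    proof -
      have "kinetic c (wderiv (U n)) \<le> J (U n)" by (simp add: J_def)
      also have "\<dots> \<le> ennreal (i + 1)" using N[of "n + N"] by (simp add: JU)
      finally show ?thesis .
    qed
    have i1: "i + 1 \<ge> 0" using i by simp
    have "norm (U n L) \<le> norm ap + r0" for n
      using UX[of n] norm_triangle_sub[of "U n L" ap] by (auto simp: X_def XL_def dest!: spec[of _ L])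
    then obtain r V where r: "strict_mono r" and V: "\<And>x. (\<lambda>k. U (r k) x) \<longlonglongrightarrow> V x"
      by (rule pointwise_convergent_subsequence[where U = U, OF c X[OF UX] K i1]) (assumption | rule that)+
    obtain h where h: "weak_deriv_L2loc V h" and h_le: "kinetic c h \<le> liminf (\<lambda>k. kinetic c (wderiv (U (r k))))"
      by (rule weak_deriv_limit[where U = "\<lambda>k. U (r k)", OF c X[OF UX] K i1 V]) (assumption | rule that)+
    have pot_le: "potential c W m L V \<le> liminf (\<lambda>k. potential c W m L (U (r k)))"
      by (rule potential_le_liminf[where U = "\<lambda>k. U (r k)", OF W weak_deriv_continuous[OF X[OF UX]] V])
    have "(\<lambda>n. J (U n)) \<longlonglongrightarrow> Inf (J ` X)"
      unfolding JU by (rule LIMSEQ_ignore_initial_segment[OF u_lim])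
    then have J_lim: "(\<lambda>k. J (U (r k))) \<longlonglongrightarrow> Inf (J ` X)"
      using LIMSEQ_subseq_LIMSEQ[OF _ r] by (simp add: comp_def)
    show ?thesis
    proof
      \<comment> \<open>Each constraint is a closed condition at a single point and survives the
        pointwise limit.\<close>
      have "norm (V x - ap) \<le> r0" if "x \<ge> L" for x
        using UX that by (intro tendsto_upperbound[OF tendsto_norm[OF tendsto_diff[OF V tendsto_const]]])
          (auto simp: X_def XL_def)
      moreover have "norm (V x - am) \<le> r0" if "x \<le> - L" for x
        using UX that by (intro tendsto_upperbound[OF tendsto_norm[OF tendsto_diff[OF V tendsto_const]]])
          (auto simp: X_def XL_def)
      ultimately show "V \<in> XL L r0 am ap"
        using h by (auto simp: XL_def H1loc_def)
      show "weak_deriv_L2loc V h" by fact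
      fix U' assume "U' \<in> XL L r0 am ap"
      have "kinetic c h + potential c W m L V \<le> liminf (\<lambda>k. J (U (r k)))"
        unfolding J_def using h_le pot_le ennreal_liminf_add_le by (meson add_mono order_trans)
      also have "\<dots> = Inf (J ` X)" by (rule lim_imp_Liminf[OF _ J_lim]) simp
      also have "\<dots> \<le> J U'" using \<open>U' \<in> _\<close> by (intro INF_lower) (simp add: X_def)
      finally show "kinetic c h + potential c W m L V \<le> kinetic c (wderiv U') + potential c W m L U'"
        by (simp add: J_def)
    qed
  qed
qed

theorem mainTheorem2:
  fixes W :: "'a::euclidean_space \<Rightarrow> real" and am ap :: 'a and r0 L c :: real
  assumes "C2_fun W"
    and "local_min W am" and "local_min W ap"
    and "W am < 0" and "W ap = 0"
    and "\<forall>u. W am \<le> W u"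
    and "compact (W -` {W am..0})"
    and "r0 > 0"
    and "\<forall>u. norm (u - ap) \<le> r0 \<longrightarrow> W u \<ge> 0"
    and "\<forall>u. norm (u - am) \<le> r0 \<longrightarrow> W u < 0"
    and "L > 0" and "c > 0"
  shows "\<exists>UL \<in> XL L r0 am ap. Ec c W UL = (INF V \<in> XL L r0 am ap. Ec c W V)"
proof -
  have W: "continuous_on UNIV W" using \<open>C2_fun W\<close> by (rule C2_fun_continuous)
  obtain V h where V: "V \<in> XL L r0 am ap" and h: "weak_deriv_L2loc V h"
    and min: "\<And>U. U \<in> XL L r0 am ap \<Longrightarrow>
      kinetic c h + potential c W (W am) L V \<le> kinetic c (wderiv U) + potential c W (W am) L U"
    by (rule XL_minimizer[OF W \<open>L > 0\<close> \<open>r0 > 0\<close> \<open>c > 0\<close>]) (assumption | rule that)+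
  define \<rho> where "\<rho> = enn2ereal (\<integral>\<^sup>+x. ennreal ((if x < L then - W am else 0) * exp (c * x)) \<partial>lebesgue)"
  \<comment> \<open>With \<open>m = W am\<close>, global minimality gives the lower bound, and the
    choice of \<open>r0\<close> around \<open>ap\<close> gives nonnegativity for
    \<open>x \<ge> L\<close>. Leaving \<open>g\<close> free covers both \<open>h\<close> for
    \<open>V\<close> and \<open>wderiv\<close> for its competitors.\<close>
  have Ec: "Ec c W U = enn2ereal (kinetic c g + potential c W (W am) L U) - \<rho>"
    if "U \<in> XL L r0 am ap" "weak_deriv_L2loc U g" for U g
    unfolding \<rho>_def by (rule Ec_eq[OF W that(2) _ less_imp_le[OF \<open>W am < 0\<close>] _ \<open>c > 0\<close>])
      (use assms that in \<open>auto simp: XL_def\<close>)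
  have "Ec c W V \<le> Ec c W U" if "U \<in> XL L r0 am ap" for U
  proof -
    have "weak_deriv_L2loc U (wderiv U)"
      using that by (intro H1loc_wderiv) (simp add: XL_def)
    then show ?thesis
      unfolding Ec[OF V h] Ec[OF that \<open>weak_deriv_L2loc U (wderiv U)\<close>]
      using min[OF that] by (intro ereal_minus_mono) (simp_all add: less_eq_ennreal.rep_eq)
  qed
  then show ?thesis using V by (intro bexI[of _ V] antisym INF_greatest INF_lower) auto
qed

end
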